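(* For every integer $d\ge 2$, the Keller graph $G_d$ is class 1, i.e., its edge-chromatic number equals its degree $4^d-3^d-d$.
   Context: The Keller graph $G_d$ has as vertices the $4^d$ tuples in $\{0,1,2,3\}^d$; two tuples $u,v$ are adjacent iff they differ in at least two coordinates and there is at least one coordinate $i$ with $u_i-v_i\equiv 2\pmod 4$. It is regular of degree $4^d-3^d-d$. A graph is class 1 if its edge-chromatic number equals its maximum degree. *)

theory Defs
  imports "HOL-Library.FuncSet" "HOL-Number_Theory.Cong"
begin

text \<open>
  A finite simple graph is given by a vertex set \<open>V\<close> and a set \<open>E\<close> of two-element subsets of \<open>V\<close>.
\<close>

definition vertex_degree :: "'a set set \<Rightarrow> 'a \<Rightarrow> nat" where
  "vertex_degree E v = card {e \<in> E. v \<in> e}"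

definition max_degree :: "'a set \<Rightarrow> 'a set set \<Rightarrow> nat" where
  "max_degree V E = Max (vertex_degree E ` V)"

definition proper_edge_colouring :: "'a set set \<Rightarrow> nat \<Rightarrow> ('a set \<Rightarrow> nat) \<Rightarrow> bool" where
  "proper_edge_colouring E k c \<longleftrightarrow>
     c \<in> E \<rightarrow> {..<k} \<and>
     (\<forall>e \<in> E. \<forall>f \<in> E. e \<noteq> f \<and> e \<inter> f \<noteq> {} \<longrightarrow> c e \<noteq> c f)"

definition chromatic_index :: "'a set set \<Rightarrow> nat" where
  "chromatic_index E = (LEAST k. \<exists>c. proper_edge_colouring E k c)"

definition class_1 :: "'a set \<Rightarrow> 'a set set \<Rightarrow> bool" where
  "class_1 V E \<longleftrightarrow> chromatic_index E = max_degree V E"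

text \<open>
  Tuples are extensional functions on the coordinate set \<open>{..<d}\<close>, so that there are exactly
  \<open>4 ^ d\<close> of them; the entries are integers so that the difference in the congruence
  is not truncated.
\<close>

definition keller_verts :: "nat \<Rightarrow> (nat \<Rightarrow> int) set" where
  "keller_verts d = {..<d} \<rightarrow>\<^sub>E {0, 1, 2, 3}"

definition keller_adj :: "nat \<Rightarrow> (nat \<Rightarrow> int) \<Rightarrow> (nat \<Rightarrow> int) \<Rightarrow> bool" where
  "keller_adj d u v \<longleftrightarrow>
     card {i \<in> {..<d}. u i \<noteq> v i} \<ge> 2 \<and> (\<exists>i \<in> {..<d}. [u i - v i = 2] (mod 4))"

definition keller_edges :: "nat \<Rightarrow> (nat \<Rightarrow> int) set set" where
  "keller_edges d = {{u, v} | u v. u \<in> keller_verts d \<and> v \<in> keller_verts d \<and> keller_adj d u v}"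

end

theory Submission
  imports Defs
begin

text \<open>
  The Keller graph is the Cayley graph of \<open>(\<int>/4)\<^sup>d\<close> with connection set \<open>keller_conn d\<close>, so its
  degree is the size of this set, and the elements of the set can serve as colours. An edge
  \<open>{u, v}\<close> whose difference has order 2 is coloured by that difference. Otherwise let \<open>i\<close> be the
  first coordinate in which the difference is odd: exactly one endpoint is even at \<open>i\<close>, and the
  edge is coloured by the difference directed away from this endpoint. Since \<open>i\<close> can be read off
  the colour, a vertex and a colour determine the direction of the edge, hence its other endpoint.
\<close>

section \<open>Edge colourings\<close>

lemma proper_edge_colouring_degree_le:
  assumes "proper_edge_colouring E k c"
  shows "vertex_degree E v \<le> k"
proof -
  have "inj_on c {e \<in> E. v \<in> e}"
    using assms by (fastforce simp: proper_edge_colouring_def inj_on_def)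
  moreover have "c ` {e \<in> E. v \<in> e} \<subseteq> {..<k}"
    using assms by (auto simp: proper_edge_colouring_def)
  ultimately show ?thesis
    unfolding vertex_degree_def using card_inj_on_le[of c _ "{..<k}"] by simp
qed

text \<open>A single vertex already forces as many colours as its degree, so a colouring that
  attains the degree of some vertex is optimal.\<close>

lemma chromatic_index_eq_degree:
  assumes "proper_edge_colouring E (vertex_degree E v) c"
  shows "chromatic_index E = vertex_degree E v"
  unfolding chromatic_index_def
  by (rule Least_equality) (use assms in blast, use proper_edge_colouring_degree_le[of E] in auto)

text \<open>Allows colours from any finite set, defined on ordered pairs. Properness then needs
  checking only between pairs with the same first vertex.\<close>

lemma proper_edge_colouring_of_pairs:
  fixes f :: "'a \<Rightarrow> 'a \<Rightarrow> 'b"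
  assumes E: "\<And>e. e \<in> E \<Longrightarrow> \<exists>u v. e = {u, v} \<and> P u v"
    and sym: "\<And>u v. P u v \<Longrightarrow> P v u \<and> f v u = f u v"
    and inj: "\<And>u v v'. P u v \<Longrightarrow> P u v' \<Longrightarrow> f u v = f u v' \<Longrightarrow> v = v'"
    and S: "finite S" "\<And>u v. P u v \<Longrightarrow> f u v \<in> S"
  shows "\<exists>c. proper_edge_colouring E (card S) c"
proof -
  obtain h where h: "bij_betw h S {..<card S}"
    using ex_bij_betw_finite_nat[OF S(1)] by (auto simp: atLeast0LessThan)
  \<comment> \<open>An edge has at most two orientations and \<open>f\<close> agrees on them, so the
    description is unique.\<close>
  define g where "g e = (THE w. \<exists>u v. e = {u, v} \<and> P u v \<and> w = f u v)" for e
  have g: "g {u, v} = f u v" if "P u v" for u v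
    unfolding g_def using that sym by (intro the_equality) (auto simp: doubleton_eq_iff)
  have "proper_edge_colouring E (card S) (h \<circ> g)"
    unfolding proper_edge_colouring_def
  proof (intro conjI ballI impI funcsetI)
    fix e assume "e \<in> E"
    then obtain u v where "e = {u, v}" "P u v" using E by blast
    then show "(h \<circ> g) e \<in> {..<card S}"
      using g S(2) bij_betwE[OF h] by simp
  next
    fix e e' assume "e \<in> E" "e' \<in> E" and ne: "e \<noteq> e' \<and> e \<inter> e' \<noteq> {}"
    then obtain x where x: "x \<in> e" "x \<in> e'" by blast
    \<comment> \<open>By symmetry both edges can be oriented to start at the shared vertex
      \<open>x\<close>, where \<open>inj\<close> applies.\<close>
    obtain v where v: "e = {x, v}" "P x v"
      using E[OF \<open>e \<in> E\<close>] x sym by blast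
    obtain v' where v': "e' = {x, v'}" "P x v'"
      using E[OF \<open>e' \<in> E\<close>] x sym by blast
    have "f x v \<noteq> f x v'" using inj v v' ne by blast
    then show "(h \<circ> g) e \<noteq> (h \<circ> g) e'"
      using v v' g S(2) bij_betw_imp_inj_on[OF h] by (auto simp: inj_on_eq_iff)
  qed
  then show ?thesis by blast
qed

section \<open>The Keller graph as a Cayley graph\<close>

text \<open>Reduced residues and restriction make the difference a vertex again, so directions are
  compared by plain equality.\<close>

definition keller_diff :: "nat \<Rightarrow> (nat \<Rightarrow> int) \<Rightarrow> (nat \<Rightarrow> int) \<Rightarrow> nat \<Rightarrow> int" where
  "keller_diff d u v = (\<lambda>i\<in>{..<d}. (v i - u i) mod 4)"

definition keller_conn :: "nat \<Rightarrow> (nat \<Rightarrow> int) set" where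
  "keller_conn d = {w \<in> keller_verts d.
     2 \<le> card {i \<in> {..<d}. w i \<noteq> 0} \<and> (\<exists>i\<in>{..<d}. w i = 2)}"

lemma finite_keller_verts: "finite (keller_verts d)"
  by (simp add: keller_verts_def finite_PiE)

lemma finite_keller_conn: "finite (keller_conn d)"
  by (simp add: keller_conn_def finite_keller_verts)

lemma keller_verts_cases:
  assumes "u \<in> keller_verts d" "i < d"
  shows "u i = 0 \<or> u i = 1 \<or> u i = 2 \<or> u i = 3"
  using assms by (auto simp: keller_verts_def PiE_iff)

lemma keller_verts_eqI:
  assumes "u \<in> keller_verts d" "v \<in> keller_verts d" "\<And>i. i < d \<Longrightarrow> u i mod 4 = v i mod 4"
  shows "u = v"
proof (rule PiE_ext)
  show "u \<in> {..<d} \<rightarrow>\<^sub>E {0, 1, 2, 3}" "v \<in> {..<d} \<rightarrow>\<^sub>E {0, 1, 2, 3}"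
    using assms by (auto simp: keller_verts_def)
  show "u i = v i" if "i \<in> {..<d}" for i
    using that assms(3)[of i] keller_verts_cases[OF assms(1), of i]
      keller_verts_cases[OF assms(2), of i] by auto
qed

lemma keller_diff_in_verts: "keller_diff d u v \<in> keller_verts d"
proof -
  have "x mod 4 \<in> {0, 1, 2, 3}" for x :: int by simp presburger
  then show ?thesis by (simp add: keller_diff_def keller_verts_def restrict_PiE_iff)
qed

text \<open>Both forms are needed because a colour may be directed away from \<open>u\<close> or
  towards it.\<close>

lemma keller_diff_cancel:
  assumes "v \<in> keller_verts d" "v' \<in> keller_verts d"
  shows "keller_diff d u v = keller_diff d u v' \<Longrightarrow> v = v'"
    and "keller_diff d v u = keller_diff d v' u \<Longrightarrow> v = v'"
proof -
  show "v = v'" if eq: "keller_diff d u v = keller_diff d u v'"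
  proof (rule keller_verts_eqI[OF assms])
    fix i assume "i < d"
    with fun_cong[OF eq, of i] have "(v i - u i) mod 4 = (v' i - u i) mod 4"
      by (simp add: keller_diff_def)
    then show "v i mod 4 = v' i mod 4" by (simp add: mod_eq_dvd_iff)
  qed
  show "v = v'" if eq: "keller_diff d v u = keller_diff d v' u"
  proof (rule keller_verts_eqI[OF assms])
    fix i assume "i < d"
    with fun_cong[OF eq, of i] have "(u i - v i) mod 4 = (u i - v' i) mod 4"
      by (simp add: keller_diff_def)
    then show "v i mod 4 = v' i mod 4" by (simp add: mod_eq_dvd_iff dvd_diff_commute)
  qed
qed

text \<open>An injective self-map of a finite set is onto, which spares constructing translates
  explicitly.\<close>

lemma keller_diff_image: "keller_diff d u ` keller_verts d = keller_verts d"
  using keller_diff_cancel(1) keller_diff_in_verts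
  by (intro endo_inj_surj finite_keller_verts) (auto simp: inj_on_def)

text \<open>Adjacency subtracts in the opposite order to \<open>keller_diff\<close>; the sign is
  harmless because 2 = -2 modulo 4.\<close>

lemma keller_adj_iff_diff:
  assumes "u \<in> keller_verts d" "v \<in> keller_verts d"
  shows "keller_adj d u v \<longleftrightarrow> keller_diff d u v \<in> keller_conn d"
proof -
  have "keller_diff d u v i \<noteq> 0 \<longleftrightarrow> u i \<noteq> v i"
    and "keller_diff d u v i = 2 \<longleftrightarrow> [u i - v i = 2] (mod 4)" if "i < d" for i
    using that keller_verts_cases[OF assms(1) that] keller_verts_cases[OF assms(2) that]
    by (auto simp: keller_diff_def cong_def)
  then have "{i \<in> {..<d}. u i \<noteq> v i} = {i \<in> {..<d}. keller_diff d u v i \<noteq> 0}"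
    and "(\<exists>i\<in>{..<d}. [u i - v i = 2] (mod 4)) \<longleftrightarrow> (\<exists>i\<in>{..<d}. keller_diff d u v i = 2)"
    by auto
  then show ?thesis
    by (simp add: keller_adj_def keller_conn_def keller_diff_in_verts)
qed

lemma keller_adj_sym: "keller_adj d u v \<longleftrightarrow> keller_adj d v u"
proof -
  have "- x mod 4 = 2 mod 4 \<longleftrightarrow> x mod 4 = 2 mod 4" for x :: int
    by presburger
  then have "[x - y = 2] (mod 4) \<longleftrightarrow> [y - x = 2] (mod 4)" for x y :: int
    unfolding cong_def by (metis minus_diff_eq)
  then show ?thesis by (simp add: keller_adj_def eq_commute)
qed

lemma keller_edges_at:
  assumes "u \<in> keller_verts d"
  shows "{e \<in> keller_edges d. u \<in> e} = (\<lambda>v. {u, v}) ` {v \<in> keller_verts d. keller_adj d u v}"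
  using assms keller_adj_sym by (fastforce simp: keller_edges_def)

text \<open>Differences from \<open>u\<close> match its neighbours with the connection set, and
  neighbours match the edges at \<open>u\<close>.\<close>

lemma keller_degree:
  assumes "u \<in> keller_verts d"
  shows "vertex_degree (keller_edges d) u = card (keller_conn d)"
proof -
  let ?N = "{v \<in> keller_verts d. keller_adj d u v}"
  have "keller_diff d u ` ?N = keller_conn d"
  proof
    show "keller_diff d u ` ?N \<subseteq> keller_conn d"
      using keller_adj_iff_diff[OF assms] by auto
    show "keller_conn d \<subseteq> keller_diff d u ` ?N"
    proof
      fix w assume w: "w \<in> keller_conn d"
      then have "w \<in> keller_diff d u ` keller_verts d"
        unfolding keller_diff_image by (simp add: keller_conn_def)
      then show "w \<in> keller_diff d u ` ?N"
        using w keller_adj_iff_diff[OF assms] by auto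
    qed
  qed
  moreover have "inj_on (keller_diff d u) ?N"
    using keller_diff_cancel(1) by (auto simp: inj_on_def)
  ultimately have "card ?N = card (keller_conn d)"
    using card_image by fastforce
  moreover have "inj_on (\<lambda>v. {u, v}) ?N"
    by (auto simp: inj_on_def doubleton_eq_iff)
  ultimately show ?thesis
    by (simp add: vertex_degree_def keller_edges_at[OF assms] card_image)
qed

text \<open>The tuples split into the connection set, the \<open>3 ^ d\<close> tuples avoiding 2,
  and the \<open>d\<close> tuples whose only nonzero entry is a 2. The additive form avoids
  truncated subtraction.\<close>

lemma card_keller_conn: "card (keller_conn d) + 3 ^ d + d = 4 ^ d"
proof -
  define A where "A = {w \<in> keller_verts d. \<forall>i\<in>{..<d}. w i \<noteq> 2}"
  define t where "t i = (\<lambda>j\<in>{..<d}. if j = i then 2 else 0 :: int)" for i :: nat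
  have support_t: "{j \<in> {..<d}. t i j \<noteq> 0} = {i}" if "i < d" for i
    using that by (auto simp: t_def)
  have t2: "t i i = 2" if "i < d" for i
    using that by (simp add: t_def)
  have tV: "t i \<in> keller_verts d" for i
    by (auto simp: t_def keller_verts_def)
  \<comment> \<open>A tuple with a 2 at \<open>i\<close> and fewer than two nonzero entries has
    support \<open>{i}\<close>.\<close>
  have single: "w = t i" if w: "w \<in> keller_verts d" and i: "i < d" "w i = 2"
    and small: "\<not> 2 \<le> card {j \<in> {..<d}. w j \<noteq> 0}" for w i
  proof -
    have "{j \<in> {..<d}. w j \<noteq> 0} = {i}"
    proof -
      have "{i} \<subseteq> {j \<in> {..<d}. w j \<noteq> 0}" using i by auto
      then show ?thesis
        using small by (intro card_seteq[symmetric]) auto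
    qed
    then show ?thesis
      using w i tV by (intro keller_verts_eqI) (auto simp: t_def)
  qed
  have V: "keller_verts d = (keller_conn d \<union> A) \<union> t ` {..<d}"
  proof
    show "keller_verts d \<subseteq> (keller_conn d \<union> A) \<union> t ` {..<d}"
    proof
      fix w assume w: "w \<in> keller_verts d"
      show "w \<in> (keller_conn d \<union> A) \<union> t ` {..<d}"
      proof (cases "w \<in> keller_conn d \<union> A")
        case False
        then obtain i where i: "i < d" "w i = 2"
          using w by (auto simp: A_def)
        then have "\<not> 2 \<le> card {j \<in> {..<d}. w j \<noteq> 0}"
          using False w by (auto simp: keller_conn_def)
        then show ?thesis using single[OF w i] i by blast
      qed blast
    qed
    show "(keller_conn d \<union> A) \<union> t ` {..<d} \<subseteq> keller_verts d"
      using tV by (auto simp: keller_conn_def A_def)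
  qed
  have inj: "inj_on t {..<d}"
  proof (rule inj_onI)
    fix i j assume "i \<in> {..<d}" "j \<in> {..<d}" "t i = t j"
    then show "i = j" using support_t[of i] support_t[of j] by simp
  qed
  have disj: "t i \<notin> keller_conn d \<union> A" if "i < d" for i
    using support_t[OF that] t2[OF that] that by (auto simp: keller_conn_def A_def)
  \<comment> \<open>Avoiding 2 is a condition on each coordinate separately, so \<open>A\<close> is
    a product of three-element sets.\<close>
  have "x \<in> {0, 1, 3} \<longleftrightarrow> x \<in> {0, 1, 2, 3} \<and> x \<noteq> 2" for x :: int
    by auto
  then have "A = {..<d} \<rightarrow>\<^sub>E {0, 1, 3}"
    by (simp only: A_def keller_verts_def set_eq_iff PiE_iff mem_Collect_eq ball_conj_distrib conj_ac)
      simp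
  then have "card A = 3 ^ d"
    by (simp add: card_PiE numeral_3_eq_3)
  moreover have "card (t ` {..<d}) = d"
    by (simp add: card_image inj)
  moreover have "card (keller_verts d) = 4 ^ d"
    by (simp add: keller_verts_def card_PiE eval_nat_numeral)
  moreover have "keller_conn d \<inter> A = {}"
    by (auto simp: keller_conn_def A_def)
  moreover have "(keller_conn d \<union> A) \<inter> t ` {..<d} = {}"
    using disj by blast
  moreover have "finite A"
    by (simp add: A_def finite_keller_verts)
  ultimately show ?thesis
    using V finite_keller_conn by (simp add: card_Un_disjoint)
qed

section \<open>The colouring\<close>

text \<open>The value of \<open>first_odd\<close> is irrelevant on tuples without an odd entry: these equal their negatives.\<close>

definition first_odd :: "nat \<Rightarrow> (nat \<Rightarrow> int) \<Rightarrow> nat" where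
  "first_odd d w = (LEAST i. i < d \<and> odd (w i))"

definition keller_colour :: "nat \<Rightarrow> (nat \<Rightarrow> int) \<Rightarrow> (nat \<Rightarrow> int) \<Rightarrow> nat \<Rightarrow> int" where
  "keller_colour d u v =
     (if even (u (first_odd d (keller_diff d u v))) then keller_diff d u v else keller_diff d v u)"

lemma even_keller_diff: "i < d \<Longrightarrow> even (keller_diff d u v i) \<longleftrightarrow> even (u i - v i)"
  by (auto simp: keller_diff_def dvd_mod_iff)

text \<open>Negation modulo 4 preserves parity.\<close>

lemma first_odd_keller_diff_commute:
  "first_odd d (keller_diff d u v) = first_odd d (keller_diff d v u)"
proof -
  have "(\<lambda>i. i < d \<and> odd (keller_diff d u v i)) = (\<lambda>i. i < d \<and> odd (keller_diff d v u i))"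
    by (auto simp: even_keller_diff fun_eq_iff)
  then show ?thesis by (simp add: first_odd_def)
qed

text \<open>The coordinate that decides the direction can thus be recovered from the colour
  alone.\<close>

lemma first_odd_keller_colour:
  "first_odd d (keller_colour d u v) = first_odd d (keller_diff d u v)"
  by (simp add: keller_colour_def first_odd_keller_diff_commute)

lemma keller_colour_commute: "keller_colour d v u = keller_colour d u v"
proof (cases "\<exists>i<d. odd (keller_diff d u v i)")
  case True
  define p where "p = first_odd d (keller_diff d u v)"
  have "p < d \<and> odd (keller_diff d u v p)"
    unfolding p_def first_odd_def using True by (rule LeastI_ex)
  \<comment> \<open>Exactly one endpoint is even at \<open>p\<close>, so both orders of the
    endpoints select the same direction.\<close>
  then have "odd (u p - v p)" using even_keller_diff by blast
  then show ?thesis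
    using first_odd_keller_diff_commute[of d u v]
    by (auto simp: keller_colour_def p_def[symmetric])
next
  case False
  have "keller_diff d u v i = keller_diff d v u i" for i
  proof (cases "i < d")
    case True
    with False have "even (u i - v i)" using even_keller_diff by blast
    \<comment> \<open>For even \<open>x\<close>, twice \<open>x\<close> is divisible by 4.\<close>
    moreover have "- x mod 4 = x mod 4" if "even x" for x :: int
      using that by presburger
    ultimately have "(v i - u i) mod 4 = (u i - v i) mod 4"
      by (metis minus_diff_eq)
    then show ?thesis by (simp add: keller_diff_def)
  qed (simp add: keller_diff_def)
  then have "keller_diff d u v = keller_diff d v u" by blast
  then show ?thesis by (simp add: keller_colour_def)
qed

text \<open>Equal colours have the same deciding coordinate, hence the same parity of
  \<open>u\<close> there. Both colours therefore use the same direction, and the difference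
  cancels.\<close>

lemma keller_colour_cancel:
  assumes "v \<in> keller_verts d" "v' \<in> keller_verts d"
    and eq: "keller_colour d u v = keller_colour d u v'"
  shows "v = v'"
proof -
  have "first_odd d (keller_diff d u v) = first_odd d (keller_diff d u v')"
    using eq first_odd_keller_colour by metis
  then show ?thesis
    using eq keller_diff_cancel[OF assms(1,2)] by (auto simp: keller_colour_def split: if_splits)
qed

lemma keller_proper_edge_colouring:
  "\<exists>c. proper_edge_colouring (keller_edges d) (card (keller_conn d)) c"
proof (rule proper_edge_colouring_of_pairs)
  let ?P = "\<lambda>u v. u \<in> keller_verts d \<and> v \<in> keller_verts d \<and> keller_adj d u v"
  show "\<exists>u v. e = {u, v} \<and> ?P u v" if "e \<in> keller_edges d" for e
    using that by (auto simp: keller_edges_def)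
  show "?P v u \<and> keller_colour d v u = keller_colour d u v" if "?P u v" for u v
    using that keller_adj_sym keller_colour_commute by blast
  show "v = v'" if "?P u v" "?P u v'" "keller_colour d u v = keller_colour d u v'" for u v v'
    using that keller_colour_cancel by blast
  \<comment> \<open>Adjacency is symmetric, so the differences in both directions lie in the
    connection set.\<close>
  show "keller_colour d u v \<in> keller_conn d" if "?P u v" for u v
    using that keller_adj_iff_diff[of u d v] keller_adj_iff_diff[of v d u] keller_adj_sym[of d u v]
    by (auto simp: keller_colour_def)
qed (rule finite_keller_conn)

theorem theorem18:
  fixes d :: nat
  assumes "d \<ge> 2"
  shows "class_1 (keller_verts d) (keller_edges d) \<and>
    int (chromatic_index (keller_edges d)) = 4 ^ d - 3 ^ d - int d"
proof -
  have "(\<lambda>i\<in>{..<d}. 0) \<in> keller_verts d"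
    by (auto simp: keller_verts_def)
  then obtain u where u: "u \<in> keller_verts d" by blast
  have index: "chromatic_index (keller_edges d) = card (keller_conn d)"
    using keller_proper_edge_colouring chromatic_index_eq_degree keller_degree[OF u] by metis
  \<comment> \<open>By regularity the maximum is taken over a singleton.\<close>
  have "vertex_degree (keller_edges d) ` keller_verts d = {card (keller_conn d)}"
    using u keller_degree by force
  then have "max_degree (keller_verts d) (keller_edges d) = card (keller_conn d)"
    by (simp add: max_degree_def)
  moreover have "int (card (keller_conn d)) + 3 ^ d + int d = 4 ^ d"
    using arg_cong[OF card_keller_conn[of d], of int] by simp
  ultimately show ?thesis
    using index by (simp add: class_1_def)
qed

end
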